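(* Let $\mathbb{X}$ be a finite dimensional real inner product space with induced norm $\|\cdot\|$, and let $\Phi:\mathbb{X}\to(-\infty,\infty]$ be a proper lower semicontinuous function that is coercive and bounded below. Let $m\ge 0$ be an integer, $a>0$, $b>0$, and let $\{x^k\}_{k\in\mathbb{N}}\subset\mathbb{X}$ be a sequence such that for each $k\in\mathbb{N}$: (H1) $\Phi(x^{k+1})+a\|x^{k+1}-x^k\|^2\le\max_{j=[k-m]_+,\ldots,k}\Phi(x^j)$; (H2) there exists $w^k\in\partial\Phi(x^k)$ such that $\|w^{k+1}\|\le b\|x^{k+1}-x^k\|$. Suppose that $\Phi$ is a KL function associated to $\varphi(t)=ct^{1-\theta}$ with $\theta\in(0,1)$ and $c>0$, that $\liminf_{k\to\infty}\Phi(x^k)\ge\lim_{k\to\infty}\Phi(x^{\ell(k)})$, and that $\limsup_{j\to\infty}\Phi(x^{k_j})\le\Phi(\widehat{x})$ for each subsequence $\{x^{k_j}\}_{j\in\mathbb{N}}$ with $\lim_{j\to\infty}x^{k_j}=\widehat{x}$. Let $\Phi^*:=\lim_{k\to\infty}\Phi(x^k)$ (this limit exists) and $\Xi_k:=\|x^{\ell(k)}-x^{\ell(k)-1}\|$. Then there exist $\overline{k}\in\mathbb{N}$ and constants $\widehat{\varrho}\in(0,1)$, $\widehat{\gamma}>0$ and $\gamma'>0$ such that for all $k\ge\overline{k}$, $$\sum_{j=k}^\infty\Xi_j\le\begin{cases}\widehat{\gamma}\,\widehat{\varrho}^{\lfloor\frac{k-1}{m+1}\rfloor}&\text{if }\theta\in(0,\frac12],\\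 \widehat{\gamma}\,k^{\frac{1-\theta}{1-2\theta}}&\text{if }\theta\in(\frac12,1),\end{cases}\qquad\text{and}\qquad \Phi(x^k)-\Phi^*\le\begin{cases}\gamma'\,\widehat{\varrho}^{\lfloor\frac{k-1}{m+1}\rfloor}&\text{if }\theta\in(0,\frac12],\\ \gamma'\,k^{\frac{1-\theta}{1-2\theta}}&\text{if }\theta\in(\frac12,1).\end{cases}$$
   Context: $[t]_+:=\max(0,t)$. For each $k$, $\ell(k)$ denotes the largest index in $\arg\max_{j=[k-m]_+,\ldots,k}\Phi(x^j)$ (under (H1), $\{\Phi(x^{\ell(k)})\}$ is nonincreasing, so its limit exists). Convention: $x^{-1}:=x^0$, so that $\Xi_k$ is defined also when $\ell(k)=0$. $\partial\Phi$ denotes the limiting (Mordukhovich) subdifferential; it is considered only at points of $\mathrm{dom}\,\Phi$. "$\Phi$ is a KL function associated to $\varphi(t)=ct^{1-\theta}$" means: for every $\overline{x}\in\mathrm{dom}\,\partial\Phi$ there exist $\eta\in(0,\infty]$ and a neighborhood $\mathcal{U}$ of $\overline{x}$ such that $\varphi'(\Phi(x)-\Phi(\overline{x}))\,\mathrm{dist}(0,\partial\Phi(x))\ge1$ for all $x\in\mathcal{U}$ with $\Phi(\overline{x})<\Phi(x)<\Phi(\overline{x})+\eta$. *)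

theory Defs
  imports "HOL-Analysis.Analysis"
begin

definition proper :: "('a \<Rightarrow> ereal) \<Rightarrow> bool" where
  "proper \<Phi> \<longleftrightarrow> (\<forall>x. \<Phi> x \<noteq> -\<infinity>) \<and> (\<exists>x. \<Phi> x \<noteq> \<infinity>)"

definition lower_semicontinuous :: "('a::topological_space \<Rightarrow> ereal) \<Rightarrow> bool" where
  "lower_semicontinuous \<Phi> \<longleftrightarrow> (\<forall>x. \<Phi> x \<le> Liminf (at x) \<Phi>)"

definition coercive :: "('a::real_normed_vector \<Rightarrow> ereal) \<Rightarrow> bool" where
  "coercive \<Phi> \<longleftrightarrow> (\<Phi> \<longlongrightarrow> \<infinity>) at_infinity"

definition bounded_below :: "('a \<Rightarrow> ereal) \<Rightarrow> bool" where
  "bounded_below \<Phi> \<longleftrightarrow> (\<exists>B::real. \<forall>x. ereal B \<le> \<Phi> x)"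

text \<open>Regular (Frechet) subdifferential; like the limiting one below, it is empty outside the
  domain of the function.\<close>

definition regular_subdiff :: "('a::real_inner \<Rightarrow> ereal) \<Rightarrow> 'a \<Rightarrow> 'a set" where
  "regular_subdiff \<Phi> x =
     {v. \<bar>\<Phi> x\<bar> \<noteq> \<infinity> \<and>
         0 \<le> Liminf (at x) (\<lambda>y. (\<Phi> y - \<Phi> x - ereal (v \<bullet> (y - x))) / ereal (norm (y - x)))}"

text \<open>Limiting (Mordukhovich) subdifferential.\<close>

definition limiting_subdiff :: "('a::real_inner \<Rightarrow> ereal) \<Rightarrow> 'a \<Rightarrow> 'a set" where
  "limiting_subdiff \<Phi> x =
     {v. \<bar>\<Phi> x\<bar> \<noteq> \<infinity> \<and>
         (\<exists>y u. y \<longlonglongrightarrow> x \<and> (\<lambda>n. \<Phi> (y n)) \<longlonglongrightarrow> \<Phi> x \<and>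
                (\<forall>n. u n \<in> regular_subdiff \<Phi> (y n)) \<and> u \<longlonglongrightarrow> v)}"

text \<open>Extended-real distance from the origin, so that the distance to the empty set is
  \<open>\<infinity>\<close>; the library's \<open>infdist\<close> and \<open>setdist\<close> are \<open>0\<close> there.\<close>

definition dist_zero :: "'a::real_normed_vector set \<Rightarrow> ereal" where
  "dist_zero S = (INF v\<in>S. ereal (norm v))"

definition KL_function :: "('a::real_inner \<Rightarrow> ereal) \<Rightarrow> (real \<Rightarrow> real) \<Rightarrow> bool" where
  "KL_function \<Phi> \<phi> \<longleftrightarrow>
     (\<forall>xbar. limiting_subdiff \<Phi> xbar \<noteq> {} \<longrightarrow>
       (\<exists>\<eta>::ereal. \<exists>U. 0 < \<eta> \<and> open U \<and> xbar \<in> U \<and>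
         (\<forall>x\<in>U. \<Phi> xbar < \<Phi> x \<and> \<Phi> x < \<Phi> xbar + \<eta> \<longrightarrow>
           1 \<le> ereal (deriv \<phi> (real_of_ereal (\<Phi> x - \<Phi> xbar))) * dist_zero (limiting_subdiff \<Phi> x))))"

text \<open>In the next definitions truncated subtraction on \<open>nat\<close> is intended: \<open>k - m\<close> is the positive
  part of the difference, and \<open>l - 1\<close> implements the convention that the iterate with index \<open>-1\<close>
  is the one with index \<open>0\<close>.\<close>

definition ell :: "('a \<Rightarrow> ereal) \<Rightarrow> (nat \<Rightarrow> 'a) \<Rightarrow> nat \<Rightarrow> nat \<Rightarrow> nat" where
  "ell \<Phi> x m k = Max {j. is_arg_max (\<lambda>j. \<Phi> (x j)) (\<lambda>j. j \<in> {k - m..k}) j}"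

definition Xi :: "('a::real_normed_vector \<Rightarrow> ereal) \<Rightarrow> (nat \<Rightarrow> 'a) \<Rightarrow> nat \<Rightarrow> nat \<Rightarrow> real" where
  "Xi \<Phi> x m k = norm (x (ell \<Phi> x m k) - x (ell \<Phi> x m k - 1))"

end

theory Submission
  imports Defs
begin

text \<open>Write \<open>p = m + 1\<close>, let \<open>M k\<close> be the maximum in (H1) and \<open>s k = M k - \<Phi>*\<close>, which decreases to
  \<open>0\<close>. As \<open>ell k \<ge> k - m\<close>, (H1) at the index \<open>ell (k + p)\<close> gives
  \<open>a * (Xi (k + p))\<^sup>2 \<le> s k - s (k + p)\<close>, and by (H2) the KL inequality, applied along the bounded
  sequence, gives \<open>s k powr \<theta> \<le> C * Xi k\<close> eventually. As \<open>s k \<le> 1\<close> eventually, \<open>\<theta>\<close> may be replaced by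
  \<open>\<tau> = max \<theta> (1/2)\<close>. Concavity of \<open>t powr (1 - \<tau>)\<close> then bounds the tail of \<open>\<Sum> Xi\<close> from \<open>k + 2 * p\<close> on
  by a multiple of \<open>s k powr (1 - \<tau>)\<close>, and the recursion
  \<open>s (k + p) powr (2 * \<tau>) \<le> K * (s k - s (k + p))\<close> yields the rate of \<open>s\<close>.\<close>

section \<open>Rates for real sequences\<close>

text \<open>Young's inequality for \<open>u powr \<tau> * v powr (1 - \<tau>)\<close>, rearranged.
  It is the tangent inequality of the concave map \<open>t powr (1 - \<tau>)\<close> at
  \<open>u\<close>, multiplied by \<open>u powr \<tau>\<close> so that it survives at
  \<open>u = 0\<close>.\<close>

lemma young_concave:
  fixes u v \<tau> :: real
  assumes "0 \<le> u" "0 \<le> v" "0 \<le> \<tau>" "\<tau> \<le> 1"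
  shows "(1 - \<tau>) * (u - v) \<le> u powr \<tau> * (u powr (1 - \<tau>) - v powr (1 - \<tau>))"
proof -
  have "u powr \<tau> * v powr (1 - \<tau>) \<le> \<tau> * u + (1 - \<tau>) * v"
    using Youngs_inequality_0[of \<tau> "1 - \<tau>" u v] assms
    by (cases "u = 0 \<or> v = 0") (auto simp: less_le)
  moreover have "u powr \<tau> * u powr (1 - \<tau>) = u"
    using assms by (simp flip: powr_add)
  ultimately show ?thesis
    by (simp add: algebra_simps)
qed

text \<open>Splitting the sum of the first \<open>n + p\<close> terms after \<open>n\<close> or
  after \<open>p\<close> terms gives the same total. This is telescoping with step \<open>p\<close>,
  which leaves \<open>p\<close> boundary terms at each end.\<close>

lemma sum_lessThan_shift:
  fixes g :: "nat \<Rightarrow> 'a::ab_group_add"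
  shows "(\<Sum>j<n. g j) - (\<Sum>j<n. g (p + j)) = (\<Sum>j<p. g j) - (\<Sum>j<p. g (n + j))"
proof (induction n)
  case (Suc n)
  have "(\<Sum>j<p. g (Suc n + j)) - (\<Sum>j<p. g (n + j)) = g (n + p) - g n"
    using sum_lessThan_telescope[of "\<lambda>j. g (n + j)" p] by (simp add: sum_subtractf)
  then have "(\<Sum>j<p. g (Suc n + j)) = (\<Sum>j<p. g (n + j)) + (g (p + n) - g n)"
    by (simp add: diff_eq_eq add.commute)
  moreover have "(\<Sum>j<n. g j) = (\<Sum>j<n. g (p + j)) + ((\<Sum>j<p. g j) - (\<Sum>j<p. g (n + j)))"
    using Suc by (simp add: diff_eq_eq add.commute)
  ultimately show ?case by simp
qed simp

text \<open>Iterating \<open>step\<close> from \<open>N\<close> contracts along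
  \<open>N + i * p\<close>, and monotonicity fills the gaps. The factor \<open>1 / q ^ N\<close>
  pays for the late start, so the bound holds for every \<open>k\<close>.\<close>

lemma antimono_geometric_decay:
  fixes s :: "nat \<Rightarrow> real"
  assumes anti: "antimono s" and nonneg: "\<And>k. 0 \<le> s k" and q: "0 < q" "q < 1" and p: "0 < p"
    and step: "\<And>k. k \<ge> N \<Longrightarrow> s (k + p) \<le> q * s k"
  shows "s k \<le> s 0 / q ^ N * q ^ (k div p)"
\<comment> \<open>In the first case \<open>q ^ (k div p) / q ^ N\<close> is at least 1, so
  \<open>s k \<le> s 0\<close> is enough.\<close>
proof (cases "k div p \<le> N")
  case True
  have "s k \<le> s 0" using anti by (simp add: antimonoD)
  also have "s 0 * q ^ N \<le> s 0 * q ^ (k div p)"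
    using q True nonneg by (intro mult_left_mono power_decreasing) auto
  then have "s 0 \<le> s 0 / q ^ N * q ^ (k div p)"
    using q by (simp add: field_simps)
  finally show ?thesis .
next
  case False
  \<comment> \<open>Giving up \<open>N\<close> whole blocks of length \<open>p\<close> covers the
    first \<open>N\<close> indices, since \<open>N \<le> N * p\<close>.\<close>
  define n where "n = k div p - N"
  have iter: "s (N + i * p) \<le> q ^ i * s N" for i
  proof (induction i)
    case (Suc i)
    have "s (N + Suc i * p) \<le> q * s (N + i * p)"
      using step[of "N + i * p"] by (simp add: algebra_simps)
    also have "\<dots> \<le> q * (q ^ i * s N)" using Suc q by simp
    finally show ?case by (simp add: mult_ac)
  qed simp
  have "N + n * p \<le> N * p + n * p" using p by simp
  also have "\<dots> = (k div p) * p" using False by (simp add: n_def algebra_simps)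
  also have "\<dots> \<le> k" by simp
  finally have "s k \<le> s (N + n * p)" using anti by (simp add: antimonoD)
  also have "\<dots> \<le> q ^ n * s N" by (rule iter)
  also have "\<dots> \<le> q ^ n * s 0" using anti q by (simp add: antimonoD)
  also have "q ^ n = q ^ (k div p) / q ^ N"
    using False q by (simp add: n_def power_diff)
  finally show ?thesis by (simp add: mult_ac)
qed

text \<open>With \<open>y = v powr \<beta> / C\<close>, one compares \<open>(1 + y) powr (- \<beta>)\<close> to a linear function of \<open>y\<close>.\<close>

lemma powr_neg_gap:
  fixes \<beta> C :: real
  assumes "0 < \<beta>" "0 < C"
  obtains \<mu> where "0 < \<mu>"
    "\<And>u v. 0 < v \<Longrightarrow> v \<le> 1 \<Longrightarrow> v powr (1 + \<beta>) \<le> C * (u - v) \<Longrightarrow> u powr (- \<beta>) + \<mu> \<le> v powr (- \<beta>)"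
proof -
  \<comment> \<open>\<open>Y\<close> bounds \<open>y\<close> because \<open>v \<le> 1\<close>. The
    slope \<open>\<nu>\<close> collects the denominators \<open>1 + Y\<close> and
    \<open>1 + \<beta> * Y\<close>, in which \<open>y\<close> has been replaced by its
    bound.\<close>
  define Y where "Y = 1 / C"
  define \<nu> where "\<nu> = \<beta> / (1 + Y) / (1 + \<beta> * Y)"
  have Y: "0 < Y" using assms by (simp add: Y_def)
  have \<nu>: "0 < \<nu>" using assms Y by (auto simp: \<nu>_def intro!: divide_pos_pos mult_pos_pos add_pos_pos)
  have main: "u powr (- \<beta>) + \<nu> * Y \<le> v powr (- \<beta>)"
    if v: "0 < v" "v \<le> 1" and uv: "v powr (1 + \<beta>) \<le> C * (u - v)" for u v
  proof -
    define y where "y = Y * v powr \<beta>"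
    have y: "0 < y" "y \<le> Y"
      using v Y assms by (auto simp: y_def powr_le1)
    have "v powr (1 + \<beta>) = v * v powr \<beta>" using v by (simp add: powr_add)
    then have "v * (1 + y) \<le> u"
      using uv assms by (simp add: y_def Y_def field_simps)
    then have "u powr (- \<beta>) \<le> (v * (1 + y)) powr (- \<beta>)"
      using v y assms by (intro powr_mono2') auto
    also have "\<dots> = v powr (- \<beta>) * (1 + y) powr (- \<beta>)"
      using v y by (simp add: powr_mult)
    finally have 1: "u powr (- \<beta>) \<le> v powr (- \<beta>) * (1 + y) powr (- \<beta>)" .
    \<comment> \<open>A lower bound for \<open>\<beta> * ln (1 + y)\<close> that is linear in
      \<open>y\<close>, from \<open>ln (1 + y) \<ge> y / (1 + y)\<close>.\<close>
    define z where "z = \<beta> * (y / (1 + Y))"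
    have z: "0 \<le> z" "z \<le> \<beta> * Y"
    proof -
      show "0 \<le> z" using y Y assms by (simp add: z_def)
      have "y / (1 + Y) \<le> Y / 1" using y Y by (intro frac_le) auto
      then show "z \<le> \<beta> * Y" unfolding z_def using assms by (intro mult_left_mono) auto
    qed
    have "y / (1 + Y) \<le> y / (1 + y)" using y by (intro divide_left_mono) auto
    also have "\<dots> = 1 - 1 / (1 + y)" using y by (simp add: field_simps)
    also have "\<dots> \<le> ln (1 + y)"
      using ln_le_minus_one[of "1 / (1 + y)"] y by (simp add: ln_div)
    finally have "z \<le> \<beta> * ln (1 + y)"
      unfolding z_def using assms by (intro mult_left_mono) auto
    then have "(1 + y) powr (- \<beta>) \<le> exp (- z)"
      using y by (simp add: powr_def)
    also have "\<dots> \<le> 1 / (1 + z)"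
      using exp_ge_add_one_self[of z] z
      by (simp add: exp_minus field_simps)
    also have "\<dots> = 1 - z / (1 + z)" using z by (simp add: field_simps)
    also have "\<dots> \<le> 1 - z / (1 + \<beta> * Y)"
      using z by (intro diff_left_mono divide_left_mono) (auto intro!: mult_pos_pos add_pos_nonneg)
    also have "\<dots> = 1 - \<nu> * y" by (simp add: z_def \<nu>_def)
    finally have "u powr (- \<beta>) \<le> v powr (- \<beta>) * (1 - \<nu> * y)"
      using 1 by (meson mult_left_mono order_trans powr_ge_zero)
    \<comment> \<open>The factor \<open>v powr \<beta>\<close> in \<open>y\<close> cancels, which
      makes the gap independent of \<open>v\<close>.\<close>
    also have "v powr (- \<beta>) * (1 - \<nu> * y) = v powr (- \<beta>) - \<nu> * Y"
      using v by (simp add: y_def algebra_simps powr_minus)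
    finally show ?thesis by simp
  qed
  show thesis using that[of "\<nu> * Y"] main \<nu> Y by simp
qed

text \<open>By \<open>powr_neg_gap\<close>, \<open>s powr (- \<beta>)\<close> grows by at least
  \<open>\<mu>\<close> over each block of \<open>p\<close> indices, hence linearly in
  \<open>k\<close>; inverting the power gives the rate.\<close>

lemma antimono_sublinear_decay:
  fixes s :: "nat \<Rightarrow> real"
  assumes anti: "antimono s" and nonneg: "\<And>k. 0 \<le> s k" and \<beta>: "0 < \<beta>" and C: "0 < C" and p: "0 < p"
    and le1: "\<And>k. k \<ge> N \<Longrightarrow> s k \<le> 1"
    and step: "\<And>k. k \<ge> N \<Longrightarrow> s (k + p) powr (1 + \<beta>) \<le> C * (s k - s (k + p))"
  obtains D where "0 < D" "\<And>k. k \<ge> 2 * (N + p) \<Longrightarrow> s k \<le> D * real k powr (- 1 / \<beta>)"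
proof -
  obtain \<mu> where \<mu>: "0 < \<mu>" and gap: "\<And>u v. 0 < v \<Longrightarrow> v \<le> 1 \<Longrightarrow>
      v powr (1 + \<beta>) \<le> C * (u - v) \<Longrightarrow> u powr (- \<beta>) + \<mu> \<le> v powr (- \<beta>)"
    using powr_neg_gap[OF \<beta> C] by blast
  \<comment> \<open>Positivity at the last index passes to the earlier ones by monotonicity. It is
    essential, since \<open>0 powr (- \<beta>)\<close> is 0.\<close>
  have iter: "\<mu> * i \<le> s (N + i * p) powr (- \<beta>)" if "0 < s (N + i * p)" for i
    using that
  proof (induction i)
    case (Suc i)
    have "s (N + Suc i * p) \<le> s (N + i * p)" using anti by (simp add: antimonoD)
    with Suc have "\<mu> * i \<le> s (N + i * p) powr (- \<beta>)" by simp
    also have "\<dots> + \<mu> \<le> s (N + Suc i * p) powr (- \<beta>)"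
      using step[of "N + i * p"] Suc.prems le1 by (intro gap) (simp_all add: algebra_simps)
    finally show ?case by (simp add: algebra_simps)
  qed simp
  define D where "D = (\<mu> / (4 * p)) powr (- 1 / \<beta>)"
  have "s k \<le> D * real k powr (- 1 / \<beta>)" if k: "k \<ge> 2 * (N + p)" for k
  proof -
    define i where "i = (k - N) div p"
    have "N + i * p \<le> k" using k by (simp add: i_def) (metis add_leD1 add_leD2 div_times_less_eq_dividend le_add_diff_inverse mult_2 nat_add_left_cancel_le)
    then have le: "s k \<le> s (N + i * p)" using anti by (simp add: antimonoD)
    have "k - N < (i + 1) * p" using p by (simp add: i_def) (metis add.commute dividend_less_times_div mult.commute mult_Suc_right)
    then have "k < N + i * p + p" by simp
    \<comment> \<open>As \<open>N + p\<close> is at most half of \<open>k\<close>, the product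
      \<open>i * p\<close> exceeds \<open>k / 2\<close>.\<close>
    then have "k \<le> i * (4 * p)" using k by simp
    then have "real k \<le> i * (4 * p)" by (metis of_nat_le_iff of_nat_mult of_nat_numeral)
    then have i: "real k / (4 * p) \<le> i" using p by (simp add: divide_le_eq)
    show ?thesis
    proof (cases "s k = 0")
      case True
      then show ?thesis by (simp add: D_def)
    next
      case False
      then have pos: "0 < s k" using nonneg[of k] by simp
      have "\<mu> / (4 * p) * k \<le> \<mu> * i" using mult_left_mono[OF i, of \<mu>] \<mu> by simp
      also have "\<dots> \<le> s (N + i * p) powr (- \<beta>)" using iter[of i] pos le by simp
      also have "\<dots> \<le> s k powr (- \<beta>)" using pos le \<beta> by (intro powr_mono2') auto
      finally have "(s k powr (- \<beta>)) powr (- 1 / \<beta>) \<le> (\<mu> / (4 * p) * k) powr (- 1 / \<beta>)"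
        using \<mu> p k \<beta> by (intro powr_mono2') auto
      then show ?thesis using pos \<beta> \<mu> by (simp add: powr_powr D_def flip: powr_mult)
    qed
  qed
  then show thesis using that[of D] \<mu> p by (simp add: D_def)
qed

text \<open>Concavity of \<open>t powr (1 - \<tau>)\<close> turns the two hypotheses into
  \<open>2 * \<xi> (k + p) \<le> \<xi> k + K * (e k - e (k + p))\<close> with \<open>e = s powr (1 - \<tau>)\<close>, which telescopes.\<close>

lemma KL_tail_sum:
  fixes s \<xi> :: "nat \<Rightarrow> real"
  assumes anti: "antimono s" and nonneg: "\<And>k. 0 \<le> s k" and \<xi>: "\<And>k. 0 \<le> \<xi> k"
    and \<tau>: "1 / 2 \<le> \<tau>" "\<tau> < 1" and a: "0 < a" and C: "0 < C" and p: "0 < p"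
    and le1: "\<And>k. k \<ge> N \<Longrightarrow> s k \<le> 1"
    and descent: "\<And>k. k \<ge> N \<Longrightarrow> a * (\<xi> (k + p))\<^sup>2 \<le> s k - s (k + p)"
    and KL: "\<And>k. k \<ge> N \<Longrightarrow> s k powr \<tau> \<le> C * \<xi> k"
  obtains D where "0 < D" "summable \<xi>"
    "\<And>k. k \<ge> N \<Longrightarrow> (\<Sum>j. \<xi> (k + 2 * p + j)) \<le> D * s k powr (1 - \<tau>)"
proof -
  define e where "e k = s k powr (1 - \<tau>)" for k
  \<comment> \<open>\<open>K\<close> arises from dividing the combined descent and KL estimates by
    \<open>a * (1 - \<tau>)\<close>. The two summands of \<open>D\<close> pay for the
    \<open>p\<close> boundary terms of \<open>\<xi>\<close> and of \<open>K * e\<close>.\<close>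
  define K where "K = C / (a * (1 - \<tau>))"
  define D where "D = p / sqrt a + K * p"
  have K: "0 < K" using a C \<tau> by (simp add: K_def)
  have D: "0 < D" using a p K by (simp add: D_def add_pos_pos)
  have e_anti: "e j \<le> e k" if "k \<le> j" for j k
    using that anti nonneg \<tau> unfolding e_def by (intro powr_mono2) (auto dest: antimonoD)
  have e_nonneg: "0 \<le> e k" for k by (simp add: e_def)
  have rec: "2 * \<xi> (k + p) \<le> \<xi> k + K * (e k - e (k + p))" if k: "k \<ge> N" for k
  proof -
    have ediff: "0 \<le> e k - e (k + p)" using e_anti[of k "k + p"] by simp
    have "(1 - \<tau>) * (a * (\<xi> (k + p))\<^sup>2) \<le> (1 - \<tau>) * (s k - s (k + p))"
      using descent[OF k] \<tau> by (intro mult_left_mono) auto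
    also have "\<dots> \<le> s k powr \<tau> * (e k - e (k + p))"
      unfolding e_def using nonneg \<tau> by (intro young_concave) auto
    also have "\<dots> \<le> C * \<xi> k * (e k - e (k + p))"
      using KL[OF k] ediff by (intro mult_right_mono)
    finally have "(\<xi> (k + p))\<^sup>2 \<le> \<xi> k * (K * (e k - e (k + p)))"
      using a \<tau> by (simp add: K_def field_simps)
    then have "\<xi> (k + p) \<le> sqrt (\<xi> k * (K * (e k - e (k + p))))"
      by (rule real_le_rsqrt)
    \<comment> \<open>The arithmetic-geometric mean inequality leaves \<open>\<xi> k\<close> with
      coefficient 1 against 2 on the left, so that one copy of the sum can be absorbed.\<close>
    also have "\<dots> \<le> (\<xi> k + K * (e k - e (k + p))) / 2"
      using \<xi> K ediff by (intro arith_geo_mean_sqrt) auto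
    finally show ?thesis by simp
  qed
  have partial: "(\<Sum>j<n. \<xi> (k + 2 * p + j)) \<le> D * e k" if k: "k \<ge> N" for n k
  proof -
    \<comment> \<open>Summation starts one block after \<open>k\<close>, so that the descent from
      \<open>k + j\<close> controls the boundary terms \<open>\<xi> (l + j)\<close>.\<close>
    define l where "l = k + p"
    have "2 * (\<Sum>j<n. \<xi> (l + (p + j))) = (\<Sum>j<n. 2 * \<xi> (l + j + p))"
      by (simp add: sum_distrib_left add_ac)
    also have "\<dots> \<le> (\<Sum>j<n. \<xi> (l + j) + K * (e (l + j) - e (l + (p + j))))"
    proof (intro sum_mono)
      fix j
      show "2 * \<xi> (l + j + p) \<le> \<xi> (l + j) + K * (e (l + j) - e (l + (p + j)))"
        using rec[of "l + j"] k by (simp add: l_def add_ac)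
    qed
    also have "\<dots> = (\<Sum>j<n. \<xi> (l + j)) + K * ((\<Sum>j<n. e (l + j)) - (\<Sum>j<n. e (l + (p + j))))"
      by (simp add: sum.distrib flip: sum_subtractf sum_distrib_left)
    finally have main: "2 * (\<Sum>j<n. \<xi> (l + (p + j))) \<le>
      (\<Sum>j<n. \<xi> (l + j)) + K * ((\<Sum>j<n. e (l + j)) - (\<Sum>j<n. e (l + (p + j))))" .
    have "(\<Sum>j<n. e (l + j)) - (\<Sum>j<n. e (l + (p + j))) \<le> (\<Sum>j<p. e (l + j))"
      using sum_lessThan_shift[of "\<lambda>j. e (l + j)" n p] e_nonneg
      by (simp add: sum_nonneg)
    also have "\<dots> \<le> (\<Sum>j<p. e k)"
      by (intro sum_mono e_anti) (simp add: l_def)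
    finally have e_sum: "(\<Sum>j<n. e (l + j)) - (\<Sum>j<n. e (l + (p + j))) \<le> p * e k"
      by simp
    have \<xi>_shift: "(\<Sum>j<n. \<xi> (l + j)) \<le> (\<Sum>j<n. \<xi> (l + (p + j))) + (\<Sum>j<p. \<xi> (l + j))"
      using sum_lessThan_shift[of "\<lambda>j. \<xi> (l + j)" n p]
        sum_nonneg[of "{..<p}" "\<lambda>j. \<xi> (l + (n + j))"] \<xi> by simp
    have "(\<Sum>j<p. \<xi> (l + j)) \<le> (\<Sum>j<p. e k / sqrt a)"
    proof (intro sum_mono)
      fix j
      have "a * (\<xi> (l + j))\<^sup>2 \<le> s (k + j) - s (k + j + p)"
        using descent[of "k + j"] k by (simp add: l_def add_ac)
      also have "\<dots> \<le> s k" using anti nonneg[of "k + j + p"] antimonoD[of s k "k + j"] by simp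
      also have "s k = s k powr 1" using nonneg by simp
      \<comment> \<open>Here \<open>\<tau> \<ge> 1/2\<close> matters: the exponent is at most 1 and
        \<open>s k \<le> 1\<close>, so the boundary terms are of the order of
        \<open>e k\<close>.\<close>
      also have "\<dots> \<le> s k powr (2 * (1 - \<tau>))"
        using nonneg le1[OF k] \<tau> by (intro powr_mono') auto
      also have "\<dots> = (e k)\<^sup>2"
        by (simp add: e_def power2_eq_square flip: powr_add)
      finally have "(\<xi> (l + j))\<^sup>2 \<le> (e k / sqrt a)\<^sup>2"
        using a by (simp add: power_divide field_simps)
      then show "\<xi> (l + j) \<le> e k / sqrt a"
        by (rule power2_le_imp_le) (use a e_nonneg[of k] in simp)
    qed
    then have "(\<Sum>j<p. \<xi> (l + j)) \<le> p / sqrt a * e k" by simp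
    then have "(\<Sum>j<n. \<xi> (l + (p + j))) \<le> D * e k"
      using main \<xi>_shift mult_left_mono[OF e_sum, of K] K
      unfolding D_def distrib_right mult.assoc by linarith
    moreover have "l + (p + j) = k + 2 * p + j" for j by (simp add: l_def)
    ultimately show ?thesis by simp
  qed
  have summ: "summable (\<lambda>j. \<xi> (k + 2 * p + j))" if "k \<ge> N" for k
    using partial[OF that] \<xi> by (intro summableI_nonneg_bounded) auto
  have "summable \<xi>"
    using summ[of N] summable_iff_shift[of \<xi> "N + 2 * p"] by (simp add: add.commute)
  moreover have "(\<Sum>j. \<xi> (k + 2 * p + j)) \<le> D * s k powr (1 - \<tau>)" if "k \<ge> N" for k
    using suminf_le_const[OF summ partial] that by (simp add: e_def)
  ultimately show thesis by (rule that[OF D])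
qed

text \<open>This serves \<open>\<tau> = 1/2\<close>, where the recursion is the contraction by
  \<open>q = K / (1 + K)\<close>; the square root has ratio \<open>sqrt q\<close>, and the shift by
  \<open>2 * p\<close> costs two powers of it.\<close>

lemma sqrt_geometric_rate:
  fixes s :: "nat \<Rightarrow> real"
  assumes anti: "antimono s" and nonneg: "\<And>k. 0 \<le> s k" and K: "0 < K" and p: "0 < p"
    and step: "\<And>k. k \<ge> N \<Longrightarrow> s (k + p) \<le> K * (s k - s (k + p))"
  obtains \<rho> G where "0 < \<rho>" "\<rho> < 1" "0 < G"
    "\<And>k. k \<ge> 2 * p \<Longrightarrow> sqrt (s (k - 2 * p)) \<le> G * \<rho> ^ ((k - 1) div p)"
proof -
  define q where "q = K / (1 + K)"
  define \<rho> where "\<rho> = sqrt q"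
  \<comment> \<open>The added 1 keeps \<open>E\<close>, and with it the final constant, positive
    even if \<open>s 0 = 0\<close>.\<close>
  define E where "E = s 0 / q ^ N + 1"
  have q: "0 < q" "q < 1" using K by (auto simp: q_def)
  have \<rho>: "0 < \<rho>" "\<rho> < 1" using q by (auto simp: \<rho>_def)
  have E: "0 < E" using q nonneg[of 0] by (simp add: E_def add_nonneg_pos)
  have "s (k + p) \<le> q * s k" if "k \<ge> N" for k
    using step[OF that] K by (simp add: q_def field_simps)
  then have decay: "s k \<le> s 0 / q ^ N * q ^ (k div p)" for k
    by (intro antimono_geometric_decay anti nonneg q p)
  have "sqrt (s (k - 2 * p)) \<le> sqrt E / \<rho>\<^sup>2 * \<rho> ^ ((k - 1) div p)" if k: "k \<ge> 2 * p" for k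
  proof -
    define i where "i = (k - 2 * p) div p"
    have "s (k - 2 * p) \<le> s 0 / q ^ N * q ^ i" unfolding i_def by (rule decay)
    also have "\<dots> \<le> E * q ^ i" using q by (intro mult_right_mono) (auto simp: E_def)
    finally have "sqrt (s (k - 2 * p)) \<le> sqrt (E * q ^ i)" by simp
    also have "\<dots> = sqrt E * \<rho> ^ i" by (simp add: \<rho>_def real_sqrt_mult real_sqrt_power)
    also have "\<dots> = sqrt E / \<rho>\<^sup>2 * \<rho> ^ (i + 2)" using \<rho> by (simp add: power_add power2_eq_square)
    also have "i + 2 = (k - 2 * p + 2 * p) div p" using p by (simp add: i_def)
    also have "\<dots> = k div p" using k by simp
    also have "sqrt E / \<rho>\<^sup>2 * \<rho> ^ (k div p) \<le> sqrt E / \<rho>\<^sup>2 * \<rho> ^ ((k - 1) div p)"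
      using \<rho> E by (intro mult_left_mono power_decreasing div_le_mono) auto
    finally show ?thesis .
  qed
  then show thesis using that[of \<rho> "sqrt E / \<rho>\<^sup>2"] \<rho> E by simp
qed

text \<open>With \<open>\<beta> = 2 * \<tau> - 1\<close> the recursion is that of
  \<open>antimono_sublinear_decay\<close>; its bound is raised to the power
  \<open>1 - \<tau>\<close>.\<close>

lemma powr_sublinear_rate:
  fixes s :: "nat \<Rightarrow> real"
  assumes anti: "antimono s" and nonneg: "\<And>k. 0 \<le> s k" and K: "0 < K" and p: "0 < p"
    and \<tau>: "1 / 2 < \<tau>" "\<tau> < 1"
    and le1: "\<And>k. k \<ge> N \<Longrightarrow> s k \<le> 1"
    and step: "\<And>k. k \<ge> N \<Longrightarrow> s (k + p) powr (2 * \<tau>) \<le> K * (s k - s (k + p))"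
  obtains G where "0 < G"
    "\<And>k. k \<ge> 2 * N + 4 * p \<Longrightarrow> s (k - 2 * p) powr (1 - \<tau>) \<le> G * real k powr ((1 - \<tau>) / (1 - 2 * \<tau>))"
proof -
  define \<beta> where "\<beta> = 2 * \<tau> - 1"
  have \<beta>: "0 < \<beta>" using \<tau> by (simp add: \<beta>_def)
  obtain E where E: "0 < E" and decay: "\<And>k. k \<ge> 2 * (N + p) \<Longrightarrow> s k \<le> E * real k powr (- 1 / \<beta>)"
    using antimono_sublinear_decay[OF anti nonneg \<beta> K p le1, of N] step
    by (auto simp: \<beta>_def)
  define G where "G = (E * (1 / 2) powr (- 1 / \<beta>)) powr (1 - \<tau>)"
  have "s (k - 2 * p) powr (1 - \<tau>) \<le> G * real k powr ((1 - \<tau>) / (1 - 2 * \<tau>))"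
    if k: "k \<ge> 2 * N + 4 * p" for k
  proof -
    have "s (k - 2 * p) \<le> E * real (k - 2 * p) powr (- 1 / \<beta>)" using k by (intro decay) auto
    \<comment> \<open>From \<open>k \<ge> 4 * p\<close> it follows that
      \<open>k - 2 * p \<ge> k / 2\<close>, and the exponent is negative.\<close>
    also have "\<dots> \<le> E * (1 / 2 * real k) powr (- 1 / \<beta>)"
      using k p \<beta> E by (intro mult_left_mono powr_mono2') auto
    also have "\<dots> = (E * (1 / 2) powr (- 1 / \<beta>)) * real k powr (- 1 / \<beta>)"
      by (subst powr_mult) auto
    finally have "s (k - 2 * p) powr (1 - \<tau>) \<le>
        ((E * (1 / 2) powr (- 1 / \<beta>)) * real k powr (- 1 / \<beta>)) powr (1 - \<tau>)"
      using nonneg \<tau> by (intro powr_mono2) auto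
    also have "\<dots> = G * real k powr (- 1 / \<beta> * (1 - \<tau>))"
      unfolding G_def using E by (subst powr_mult) (auto simp: powr_powr)
    also have "- 1 / \<beta> * (1 - \<tau>) = (1 - \<tau>) / (1 - 2 * \<tau>)"
      using \<tau> by (simp add: \<beta>_def field_simps)
    finally show ?thesis .
  qed
  then show thesis using that[of G] E by (simp add: G_def)
qed

text \<open>The analytic content, freed of \<open>\<Phi>\<close>. The maximum of tail and gap is
  bounded at once because both are dominated by a multiple of \<open>s powr (1 - \<tau>)\<close> two
  blocks earlier.\<close>

lemma nonmonotone_KL_rates:
  fixes s \<xi> :: "nat \<Rightarrow> real"
  assumes anti: "antimono s" and nonneg: "\<And>k. 0 \<le> s k" and \<xi>: "\<And>k. 0 \<le> \<xi> k"
    and \<theta>: "0 < \<theta>" "\<theta> < 1" and a: "0 < a" and C: "0 < C" and s0: "s \<longlonglongrightarrow> 0"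
    and descent: "\<And>k. a * (\<xi> (k + (m + 1)))\<^sup>2 \<le> s k - s (k + (m + 1))"
    and KL: "\<forall>\<^sub>F k in sequentially. s k powr \<theta> \<le> C * \<xi> k"
  shows "summable \<xi> \<and> (\<exists>kbar \<rho> \<gamma>. 0 < \<rho> \<and> \<rho> < 1 \<and> 0 < \<gamma> \<and>
    (\<forall>k\<ge>kbar. max (\<Sum>j. \<xi> (k + j)) (s k) \<le>
       (if \<theta> \<le> 1/2 then \<gamma> * \<rho> powi \<lfloor>(real k - 1) / (real m + 1)\<rfloor>
        else \<gamma> * real k powr ((1 - \<theta>) / (1 - 2 * \<theta>)))))"
proof -
  define p where "p = m + 1"
  define \<tau> where "\<tau> = max \<theta> (1/2)"
  have p: "0 < p" by (simp add: p_def)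
  have \<tau>: "1/2 \<le> \<tau>" "\<theta> \<le> \<tau>" "\<tau> < 1" using \<theta> by (auto simp: \<tau>_def)
  have "\<forall>\<^sub>F k in sequentially. s k < 1" using s0 by (rule order_tendstoD) simp
  from eventually_conj[OF KL this] obtain N
    where N: "\<And>k. k \<ge> N \<Longrightarrow> s k powr \<theta> \<le> C * \<xi> k \<and> s k < 1"
    unfolding eventually_sequentially by metis
  have le1: "s k \<le> 1" if "k \<ge> N" for k using N[OF that] by simp
  have KL\<tau>: "s k powr \<tau> \<le> C * \<xi> k" if "k \<ge> N" for k
  proof -
    have "s k powr \<tau> \<le> s k powr \<theta>" using nonneg le1[OF that] \<tau> by (intro powr_mono') auto
    then show ?thesis using N[OF that] by simp
  qed
  have descent': "a * (\<xi> (k + p))\<^sup>2 \<le> s k - s (k + p)" for k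
    using descent unfolding p_def .
  obtain D where D: "0 < D" and summ: "summable \<xi>"
    and tail: "\<And>k. k \<ge> N \<Longrightarrow> (\<Sum>j. \<xi> (k + 2 * p + j)) \<le> D * s k powr (1 - \<tau>)"
    by (rule KL_tail_sum[where N = N, OF anti nonneg \<xi> \<tau>(1) \<tau>(3) a C p le1 descent' KL\<tau>], assumption+) (rule that)
  have both: "max (\<Sum>j. \<xi> (k + j)) (s k) \<le> (D + 1) * s (k - 2 * p) powr (1 - \<tau>)"
    if k: "k \<ge> N + 2 * p" for k
  proof -
    define l where "l = k - 2 * p"
    have l: "l \<ge> N" "k = l + 2 * p" using k by (auto simp: l_def)
    have "s k \<le> s l" using l(2) by (intro antimonoD[OF anti]) simp
    also have "\<dots> = s l powr 1" using nonneg by simp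
    also have "\<dots> \<le> s l powr (1 - \<tau>)" using nonneg le1[OF l(1)] \<tau> \<theta> by (intro powr_mono') auto
    finally have "s k \<le> s l powr (1 - \<tau>)" .
    moreover have "(\<Sum>j. \<xi> (k + j)) \<le> D * s l powr (1 - \<tau>)" using tail[OF l(1)] by (simp add: l)
    moreover have "0 \<le> D * s l powr (1 - \<tau>)" "0 \<le> s l powr (1 - \<tau>)" using D by auto
    ultimately show ?thesis unfolding l_def[symmetric] distrib_right by linarith
  qed
  define K where "K = C\<^sup>2 / a"
  have K: "0 < K" using C a by (simp add: K_def)
  \<comment> \<open>Squaring the KL bound at \<open>k + p\<close> and inserting the descent
    eliminates \<open>\<xi>\<close>.\<close>
  have step: "s (k + p) powr (2 * \<tau>) \<le> K * (s k - s (k + p))" if k: "k \<ge> N" for k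
  proof -
    have "s (k + p) powr (2 * \<tau>) = (s (k + p) powr \<tau>)\<^sup>2"
      by (simp add: power2_eq_square flip: powr_add)
    also have "\<dots> \<le> (C * \<xi> (k + p))\<^sup>2" using KL\<tau>[of "k + p"] k by (intro power_mono) auto
    also have "\<dots> = K * (a * (\<xi> (k + p))\<^sup>2)" using a by (simp add: K_def power_mult_distrib)
    also have "\<dots> \<le> K * (s k - s (k + p))" using descent' K by (intro mult_left_mono) auto
    finally show ?thesis .
  qed
  show ?thesis
  proof (cases "\<theta> \<le> 1/2")
    case True
    then have half: "\<tau> = 1/2" by (simp add: \<tau>_def)
    have half_step: "s (k + p) \<le> K * (s k - s (k + p))" if "k \<ge> N" for k
      using step[OF that] nonneg[of "k + p"] by (simp add: half)
    obtain \<rho> G where \<rho>: "0 < \<rho>" "\<rho> < 1" and G: "0 < G"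
      and rate: "\<And>k. k \<ge> 2 * p \<Longrightarrow> sqrt (s (k - 2 * p)) \<le> G * \<rho> ^ ((k - 1) div p)"
      by (rule sqrt_geometric_rate[where N = N, OF anti nonneg K p half_step], assumption+) (rule that)
    have "max (\<Sum>j. \<xi> (k + j)) (s k) \<le>
        (D + 1) * G * \<rho> powi \<lfloor>(real k - 1) / (real m + 1)\<rfloor>" if k: "k \<ge> N + 2 * p" for k
    proof -
      \<comment> \<open>Since \<open>k \<ge> 1\<close>, truncated subtraction agrees with the real
        one, and the integer power becomes a natural one.\<close>
      have "(real k - 1) / (real m + 1) = real (k - 1) / real p" using k p by (simp add: p_def of_nat_diff)
      then have "\<lfloor>(real k - 1) / (real m + 1)\<rfloor> = int ((k - 1) div p)"
        by (simp only: floor_divide_of_nat_eq)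
      then have powi: "\<rho> powi \<lfloor>(real k - 1) / (real m + 1)\<rfloor> = \<rho> ^ ((k - 1) div p)"
        by (simp only: power_int_of_nat)
      have "max (\<Sum>j. \<xi> (k + j)) (s k) \<le> (D + 1) * sqrt (s (k - 2 * p))"
        using both[OF k] nonneg by (simp add: half powr_half_sqrt)
      also have "\<dots> \<le> (D + 1) * (G * \<rho> ^ ((k - 1) div p))"
        using rate[of k] k D by (intro mult_left_mono) auto
      finally show ?thesis unfolding powi by (simp only: mult.assoc)
    qed
    then show ?thesis using True summ \<rho> G D
      by (intro conjI exI[of _ "N + 2 * p"] exI[of _ \<rho>] exI[of _ "(D + 1) * G"]) auto
  next
    case False
    then have \<theta>': "\<tau> = \<theta>" "1/2 < \<theta>" by (auto simp: \<tau>_def)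
    obtain G where G: "0 < G" and rate: "\<And>k. k \<ge> 2 * N + 4 * p \<Longrightarrow>
        s (k - 2 * p) powr (1 - \<theta>) \<le> G * real k powr ((1 - \<theta>) / (1 - 2 * \<theta>))"
      by (rule powr_sublinear_rate[where N = N, OF anti nonneg K p \<theta>'(2) \<theta>(2) le1
            step[unfolded \<theta>'(1)]], assumption+) (rule that)
    have "max (\<Sum>j. \<xi> (k + j)) (s k) \<le> (D + 1) * G * real k powr ((1 - \<theta>) / (1 - 2 * \<theta>))"
      if k: "k \<ge> 2 * N + 4 * p" for k
    proof -
      have "max (\<Sum>j. \<xi> (k + j)) (s k) \<le> (D + 1) * s (k - 2 * p) powr (1 - \<theta>)"
        using both[of k] k by (simp add: \<theta>')
      also have "\<dots> \<le> (D + 1) * (G * real k powr ((1 - \<theta>) / (1 - 2 * \<theta>)))"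
        using rate[OF k] D by (intro mult_left_mono) auto
      finally show ?thesis by (simp only: mult.assoc)
    qed
    \<comment> \<open>\<open>\<rho>\<close> does not occur in the rate for
      \<open>\<theta> > 1/2\<close>; the witness 1/2 is a default.\<close>
    then show ?thesis using False summ G D
      by (intro conjI exI[of _ "2 * N + 4 * p"] exI[of _ "1/2"] exI[of _ "(D + 1) * G"]) auto
  qed
qed

section \<open>Subdifferentials and the KL inequality along a sequence\<close>

lemma tendsto_of_dist_less_inverse:
  fixes u v :: "nat \<Rightarrow> 'a::metric_space"
  assumes "\<And>n. dist (u n) (v n) < 1 / real (Suc n)" "v \<longlonglongrightarrow> w"
  shows "u \<longlonglongrightarrow> w"
proof -
  have inv: "(\<lambda>n. 1 / real (Suc n)) \<longlonglongrightarrow> 0"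
    using LIMSEQ_inverse_real_of_nat by (simp add: inverse_eq_divide)
  have le: "dist (u n) w \<le> 1 / real (Suc n) + dist (v n) w" for n
    using assms(1)[of n] dist_triangle[of "u n" w "v n"] by linarith
  have "(\<lambda>n. dist (v n) w) \<longlonglongrightarrow> 0"
    using assms(2) by (rule tendsto_dist_iff[THEN iffD1])
  from tendsto_add[OF inv this] have "(\<lambda>n. 1 / real (Suc n) + dist (v n) w) \<longlonglongrightarrow> 0"
    by simp
  then have "(\<lambda>n. dist (u n) w) \<longlonglongrightarrow> 0"
    by (rule tendsto_sandwich[OF always_eventually always_eventually tendsto_const, rotated 2])
      (simp_all only: le zero_le_dist simp_thms)
  then show ?thesis by (rule tendsto_dist_iff[THEN iffD2])
qed

text \<open>A diagonal argument: for each \<open>n\<close> a regular subgradient is picked whose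
  base point, function value and vector lie within \<open>1 / Suc n\<close> of those at
  \<open>y n\<close>. Values are compared as reals, being finite wherever a subgradient
  exists.\<close>

lemma limiting_subdiff_closed:
  fixes \<Phi> :: "'a::real_inner \<Rightarrow> ereal"
  assumes y: "y \<longlonglongrightarrow> x" and \<Phi>y: "(\<lambda>n. \<Phi> (y n)) \<longlonglongrightarrow> \<Phi> x" and fin: "\<bar>\<Phi> x\<bar> \<noteq> \<infinity>"
    and v: "\<And>n. v n \<in> limiting_subdiff \<Phi> (y n)" "v \<longlonglongrightarrow> w"
  shows "w \<in> limiting_subdiff \<Phi> x"
proof -
  have finy: "\<bar>\<Phi> (y n)\<bar> \<noteq> \<infinity>" for n using v by (simp add: limiting_subdiff_def)
  have "\<exists>z u. dist z (y n) < 1 / real (Suc n) \<and> dist (real_of_ereal (\<Phi> z)) (real_of_ereal (\<Phi> (y n))) < 1 / real (Suc n) \<and>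
      u \<in> regular_subdiff \<Phi> z \<and> dist u (v n) < 1 / real (Suc n)" for n
  proof -
    obtain z u where zu: "z \<longlonglongrightarrow> y n" "(\<lambda>i. \<Phi> (z i)) \<longlonglongrightarrow> \<Phi> (y n)"
        "\<And>i. u i \<in> regular_subdiff \<Phi> (z i)" "u \<longlonglongrightarrow> v n"
      using v(1)[of n] by (auto simp: limiting_subdiff_def)
    have "(\<lambda>i. real_of_ereal (\<Phi> (z i))) \<longlonglongrightarrow> real_of_ereal (\<Phi> (y n))"
      using zu(2) finy[of n] by (intro lim_real_of_ereal) (simp add: ereal_real')
    then have "\<forall>\<^sub>F i in sequentially. dist (z i) (y n) < 1 / real (Suc n) \<and>
        dist (real_of_ereal (\<Phi> (z i))) (real_of_ereal (\<Phi> (y n))) < 1 / real (Suc n) \<and>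
        dist (u i) (v n) < 1 / real (Suc n)"
      using zu by (intro eventually_conj tendstoD) auto
    then obtain i where "dist (z i) (y n) < 1 / real (Suc n) \<and>
        dist (real_of_ereal (\<Phi> (z i))) (real_of_ereal (\<Phi> (y n))) < 1 / real (Suc n) \<and>
        dist (u i) (v n) < 1 / real (Suc n)"
      using eventually_happens'[OF sequentially_bot] by blast
    then show ?thesis using zu(3)[of i] by blast
  qed
  then obtain z u where
    zu: "\<And>n. dist (z n) (y n) < 1 / real (Suc n)"
      "\<And>n. dist (real_of_ereal (\<Phi> (z n))) (real_of_ereal (\<Phi> (y n))) < 1 / real (Suc n)"
      "\<And>n. u n \<in> regular_subdiff \<Phi> (z n)" "\<And>n. dist (u n) (v n) < 1 / real (Suc n)"
    by metis
  have 1: "z \<longlonglongrightarrow> x" using zu(1) y by (rule tendsto_of_dist_less_inverse)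
  have 2: "u \<longlonglongrightarrow> w" using zu(4) v(2) by (rule tendsto_of_dist_less_inverse)
  have "(\<lambda>n. real_of_ereal (\<Phi> (y n))) \<longlonglongrightarrow> real_of_ereal (\<Phi> x)"
    using \<Phi>y fin by (intro lim_real_of_ereal) (simp add: ereal_real')
  with zu(2) have "(\<lambda>n. real_of_ereal (\<Phi> (z n))) \<longlonglongrightarrow> real_of_ereal (\<Phi> x)"
    by (rule tendsto_of_dist_less_inverse)
  then have "(\<lambda>n. ereal (real_of_ereal (\<Phi> (z n)))) \<longlonglongrightarrow> ereal (real_of_ereal (\<Phi> x))"
    by (rule tendsto_ereal)
  moreover have "\<bar>\<Phi> (z n)\<bar> \<noteq> \<infinity>" for n using zu(3)[of n] by (simp add: regular_subdiff_def)
  ultimately have "(\<lambda>n. \<Phi> (z n)) \<longlonglongrightarrow> \<Phi> x" using fin by (simp add: ereal_real')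
  with 1 2 fin zu(3) show ?thesis by (auto simp: limiting_subdiff_def)
qed

text \<open>The derivative of the desingularizing function at \<open>t > 0\<close> is
  \<open>c * (1 - \<theta>) * t powr (- \<theta>)\<close>, and any subgradient bounds the distance
  from above. Convergence of points and values brings the sequence into the KL region, apart from
  the strict inequality kept as a premise.\<close>

lemma KL_function_powr_eventually:
  fixes \<Phi> :: "'a::real_inner \<Rightarrow> ereal"
  assumes KL: "KL_function \<Phi> (\<lambda>t. c * t powr (1 - \<theta>))" and c: "0 < c" and \<theta>: "\<theta> < 1"
    and ne: "limiting_subdiff \<Phi> xbar \<noteq> {}"
    and y: "y \<longlonglongrightarrow> xbar" and \<Phi>y: "(\<lambda>n. \<Phi> (y n)) \<longlonglongrightarrow> \<Phi> xbar"
    and w: "\<And>n. w n \<in> limiting_subdiff \<Phi> (y n)"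
  shows "\<forall>\<^sub>F n in sequentially. \<Phi> xbar < \<Phi> (y n) \<longrightarrow>
    real_of_ereal (\<Phi> (y n) - \<Phi> xbar) powr \<theta> \<le> c * (1 - \<theta>) * norm (w n)"
proof -
  have fin: "\<bar>\<Phi> xbar\<bar> \<noteq> \<infinity>" using ne by (auto simp: limiting_subdiff_def)
  obtain \<eta> :: ereal and U where \<eta>: "0 < \<eta>" and U: "open U" "xbar \<in> U"
    and KLU: "\<And>x. x \<in> U \<Longrightarrow> \<Phi> xbar < \<Phi> x \<Longrightarrow> \<Phi> x < \<Phi> xbar + \<eta> \<Longrightarrow>
      1 \<le> ereal (deriv (\<lambda>t. c * t powr (1 - \<theta>)) (real_of_ereal (\<Phi> x - \<Phi> xbar))) *
        dist_zero (limiting_subdiff \<Phi> x)"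
    using KL ne unfolding KL_function_def by blast
  have "\<Phi> xbar < \<Phi> xbar + \<eta>" using fin \<eta> by (cases "\<Phi> xbar"; cases \<eta>) auto
  then have "\<forall>\<^sub>F n in sequentially. \<Phi> (y n) < \<Phi> xbar + \<eta>"
    using \<Phi>y by (rule order_tendstoD(2)[rotated])
  moreover have "\<forall>\<^sub>F n in sequentially. y n \<in> U" using y U by (rule topological_tendstoD)
  ultimately show ?thesis
  proof eventually_elim
    case (elim n)
    show ?case
    proof
      assume less: "\<Phi> xbar < \<Phi> (y n)"
      define t where "t = real_of_ereal (\<Phi> (y n) - \<Phi> xbar)"
      have finy: "\<bar>\<Phi> (y n)\<bar> \<noteq> \<infinity>" using w[of n] by (simp add: limiting_subdiff_def)
      have t: "0 < t"
        using less fin finy unfolding t_def by (cases "\<Phi> xbar"; cases "\<Phi> (y n)") auto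
      have "((\<lambda>t. c * t powr (1 - \<theta>)) has_real_derivative c * ((1 - \<theta>) * t powr (1 - \<theta> - 1))) (at t)"
        using t by (intro DERIV_cmult has_real_derivative_powr)
      then have d: "deriv (\<lambda>t. c * t powr (1 - \<theta>)) t = c * (1 - \<theta>) * t powr (- \<theta>)"
        by (simp add: DERIV_imp_deriv)
      have "dist_zero (limiting_subdiff \<Phi> (y n)) \<le> ereal (norm (w n))"
        unfolding dist_zero_def by (intro INF_lower w)
      then have "ereal (c * (1 - \<theta>) * t powr (- \<theta>)) * dist_zero (limiting_subdiff \<Phi> (y n))
          \<le> ereal (c * (1 - \<theta>) * t powr (- \<theta>)) * ereal (norm (w n))"
        using c \<theta> by (intro ereal_mult_left_mono) auto
      moreover have "1 \<le> ereal (c * (1 - \<theta>) * t powr (- \<theta>)) * dist_zero (limiting_subdiff \<Phi> (y n))"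
        using KLU[of "y n"] elim less unfolding t_def[symmetric] d by blast
      ultimately have "1 \<le> ereal (c * (1 - \<theta>) * t powr (- \<theta>)) * ereal (norm (w n))"
        by (rule order_trans[rotated])
      then have "1 \<le> c * (1 - \<theta>) * t powr (- \<theta>) * norm (w n)"
        unfolding times_ereal.simps one_ereal_def ereal_less_eq .
      then show "t powr \<theta> \<le> c * (1 - \<theta>) * norm (w n)"
        using t by (simp add: powr_minus field_simps)
    qed
  qed
qed

lemma lower_semicontinuous_limit:
  fixes \<Phi> :: "'a::first_countable_topology \<Rightarrow> ereal"
  assumes lsc: "lower_semicontinuous \<Phi>" and y: "y \<longlonglongrightarrow> x"
  shows "\<Phi> x \<le> liminf (\<lambda>n. \<Phi> (y n))"
  unfolding le_Liminf_iff
proof (intro allI impI)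
  fix l assume l: "l < \<Phi> x"
  then have "l < Liminf (at x) \<Phi>"
    using lsc unfolding lower_semicontinuous_def by (metis order_less_le_trans)
  then have "\<forall>\<^sub>F z in at x. l < \<Phi> z" by (rule less_LiminfD)
  \<comment> \<open>The punctured filter \<open>at x\<close> ignores \<open>x\<close> itself, which
    the sequence may hit; \<open>l < \<Phi> x\<close> fills this hole.\<close>
  then have "\<forall>\<^sub>F z in nhds x. l < \<Phi> z"
    using l unfolding eventually_at_filter by (auto elim!: eventually_mono)
  then show "\<forall>\<^sub>F n in sequentially. l < \<Phi> (y n)"
    using y by (rule eventually_compose_filterlim)
qed

lemma coercive_sublevel_bounded:
  fixes \<Phi> :: "'a::real_normed_vector \<Rightarrow> ereal"
  assumes "coercive \<Phi>" "V < \<infinity>"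
  shows "bounded {z. \<Phi> z \<le> V}"
proof -
  have "\<forall>\<^sub>F z in at_infinity. V < \<Phi> z"
    using assms order_tendstoD(1) unfolding coercive_def by blast
  then obtain B where "\<And>z. B \<le> norm z \<Longrightarrow> V < \<Phi> z"
    unfolding eventually_at_infinity by blast
  then show ?thesis unfolding bounded_iff by (metis linorder_le_cases linorder_not_le mem_Collect_eq)
qed

text \<open>The set of maximizers is finite and nonempty, so the \<open>Max\<close> defining
  \<open>ell\<close> is itself a maximizer.\<close>

lemma ell_in: "ell \<Phi> x m k \<in> {k - m..k}"
  and \<Phi>_ell: "\<Phi> (x (ell \<Phi> x m k)) = Max ((\<lambda>j. \<Phi> (x j)) ` {k - m..k})"
proof -
  let ?A = "{j. is_arg_max (\<lambda>j. \<Phi> (x j)) (\<lambda>j. j \<in> {k - m..k}) j}"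
  have "Max ((\<lambda>j. \<Phi> (x j)) ` {k - m..k}) \<in> (\<lambda>j. \<Phi> (x j)) ` {k - m..k}"
    by (intro Max_in) auto
  then obtain j where j: "j \<in> {k - m..k}" "\<Phi> (x j) = Max ((\<lambda>j. \<Phi> (x j)) ` {k - m..k})"
    by (metis (no_types, lifting) imageE)
  have "j \<in> ?A" using j by (auto simp: is_arg_max_linorder)
  moreover have "finite ?A" by (rule finite_subset[of _ "{k - m..k}"]) (auto simp: is_arg_max_def)
  ultimately have "ell \<Phi> x m k \<in> ?A" unfolding ell_def by (intro Max_in) auto
  then have *: "ell \<Phi> x m k \<in> {k - m..k}"
      "\<And>i. i \<in> {k - m..k} \<Longrightarrow> \<Phi> (x i) \<le> \<Phi> (x (ell \<Phi> x m k))"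
    by (auto simp: is_arg_max_linorder)
  then show "ell \<Phi> x m k \<in> {k - m..k}" by blast
  show "\<Phi> (x (ell \<Phi> x m k)) = Max ((\<lambda>j. \<Phi> (x j)) ` {k - m..k})"
    using * by (intro Max_eqI[symmetric]) auto
qed

theorem lemma3p8:
  fixes \<Phi> :: "'a::euclidean_space \<Rightarrow> ereal"
    and x :: "nat \<Rightarrow> 'a"
    and m :: nat
    and a b c \<theta> :: real
  assumes "proper \<Phi>" and "lower_semicontinuous \<Phi>" and "coercive \<Phi>" and "bounded_below \<Phi>"
    and "a > 0" and "b > 0"
    and H1: "\<And>k. \<Phi> (x (k + 1)) + ereal (a * (norm (x (k + 1) - x k))\<^sup>2)
                   \<le> Max ((\<lambda>j. \<Phi> (x j)) ` {k - m..k})"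
    and H2: "\<exists>w. \<forall>k. w k \<in> limiting_subdiff \<Phi> (x k) \<and>
                   norm (w (k + 1)) \<le> b * norm (x (k + 1) - x k)"
    and "0 < \<theta>" and "\<theta> < 1" and "c > 0"
    and KL: "KL_function \<Phi> (\<lambda>t. c * t powr (1 - \<theta>))"
    and "liminf (\<lambda>k. \<Phi> (x k)) \<ge> lim (\<lambda>k. \<Phi> (x (ell \<Phi> x m k)))"
    and "\<And>r xhat. strict_mono r \<Longrightarrow> (\<lambda>j. x (r j)) \<longlonglongrightarrow> xhat
                   \<Longrightarrow> limsup (\<lambda>j. \<Phi> (x (r j))) \<le> \<Phi> xhat"
  shows "\<exists>\<Phi>star::real. (\<lambda>k. \<Phi> (x k)) \<longlonglongrightarrow> ereal \<Phi>star \<and>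
           summable (Xi \<Phi> x m) \<and>
           (\<exists>(kbar::nat) (\<rho>::real) (\<gamma>::real) (\<gamma>'::real).
              0 < \<rho> \<and> \<rho> < 1 \<and> 0 < \<gamma> \<and> 0 < \<gamma>' \<and>
              (\<forall>k\<ge>kbar.
                 (\<Sum>j. Xi \<Phi> x m (k + j))
                   \<le> (if \<theta> \<le> 1/2 then \<gamma> * \<rho> powi \<lfloor>(real k - 1) / (real m + 1)\<rfloor>
                      else \<gamma> * real k powr ((1 - \<theta>) / (1 - 2 * \<theta>))) \<and>
                 \<Phi> (x k) - ereal \<Phi>star
                   \<le> ereal (if \<theta> \<le> 1/2 then \<gamma>' * \<rho> powi \<lfloor>(real k - 1) / (real m + 1)\<rfloor>
                            else \<gamma>' * real k powr ((1 - \<theta>) / (1 - 2 * \<theta>)))))"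
proof -

  \<comment> \<open>Window maxima and convergence of the function values\<close>
  obtain w where w: "\<And>k. w k \<in> limiting_subdiff \<Phi> (x k)"
    and w_le: "\<And>k. norm (w (k + 1)) \<le> b * norm (x (k + 1) - x k)"
    using H2 by blast
  define f where "f k = real_of_ereal (\<Phi> (x k))" for k
  define l where "l = ell \<Phi> x m"
  define M where "M k = f (l k)" for k
  have \<Phi>f: "\<Phi> (x k) = ereal (f k)" for k
    using w[of k] by (simp add: limiting_subdiff_def f_def ereal_real')
  have l: "k - m \<le> l k" "l k \<le> k" for k
    using ell_in[of \<Phi> x m k] by (auto simp: l_def)
  have MaxM: "Max ((\<lambda>j. \<Phi> (x j)) ` {k - m..k}) = ereal (M k)" for k
    using \<Phi>_ell[of \<Phi> x m k] by (simp add: \<Phi>f M_def l_def)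
  have f_le: "f j \<le> M k" if "k - m \<le> j" "j \<le> k" for j k
  proof -
    have "\<Phi> (x j) \<le> Max ((\<lambda>j. \<Phi> (x j)) ` {k - m..k})" using that by (intro Max_ge) auto
    then show ?thesis unfolding MaxM unfolding \<Phi>f by simp
  qed
  have descent: "f (Suc k) + a * (norm (x (Suc k) - x k))\<^sup>2 \<le> M k" for k
    using H1[of k] unfolding MaxM unfolding \<Phi>f by simp
  have f_Suc_le: "f (Suc k) \<le> M k" for k
    using descent[of k] \<open>a > 0\<close> by (smt (verit) mult_nonneg_nonneg zero_le_power2)
  \<comment> \<open>Either the maximum is attained at the new index, where (H1) bounds it, or at an
    index of the previous window.\<close>
  have "M (Suc k) \<le> M k" for k
  proof (cases "l (Suc k) = Suc k")
    case False
    with l[of "Suc k"] show ?thesis unfolding M_def[of "Suc k"] by (intro f_le) auto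
  qed (simp add: M_def[of "Suc k"] f_Suc_le)
  then have anti: "antimono M" by (simp add: decseq_Suc_iff)
  obtain B where "\<And>z. ereal B \<le> \<Phi> z"
    using \<open>bounded_below \<Phi>\<close> by (auto simp: bounded_below_def)
  then have "B \<le> M k" for k by (metis M_def \<Phi>f ereal_less_eq(3))
  with anti obtain \<Phi>s where M_lim: "M \<longlonglongrightarrow> \<Phi>s" and M_ge: "\<And>k. \<Phi>s \<le> M k"
    using decseq_convergent[of M B] by auto
  have "(\<lambda>k. \<Phi> (x (ell \<Phi> x m k))) \<longlonglongrightarrow> ereal \<Phi>s"
    using tendsto_ereal[OF M_lim] by (simp add: M_def \<Phi>f l_def)
  then have inf: "ereal \<Phi>s \<le> liminf (\<lambda>k. \<Phi> (x k))"
    using assms(13) by (simp add: limI)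
  have "limsup (\<lambda>k. \<Phi> (x k)) \<le> limsup (\<lambda>k. ereal (M k))"
    by (intro Limsup_mono always_eventually allI) (simp add: \<Phi>f f_le)
  also have "\<dots> = ereal \<Phi>s"
    using tendsto_ereal[OF M_lim] by (intro lim_imp_Limsup) simp_all
  finally have \<Phi>_lim: "(\<lambda>k. \<Phi> (x k)) \<longlonglongrightarrow> ereal \<Phi>s"
    using inf Liminf_le_Limsup[of sequentially "\<lambda>k. \<Phi> (x k)"]
    by (intro Liminf_eq_Limsup) auto
  then have f_lim: "f \<longlonglongrightarrow> \<Phi>s" by (simp add: \<Phi>f)

  \<comment> \<open>Vanishing subgradients and bounded iterates\<close>
  have "(\<lambda>k. b * sqrt ((M k - f (Suc k)) / a)) \<longlonglongrightarrow> b * sqrt ((\<Phi>s - \<Phi>s) / a)"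
    using f_lim M_lim \<open>a > 0\<close> by (intro tendsto_intros LIMSEQ_Suc) auto
  then have rhs_lim: "(\<lambda>k. b * sqrt ((M k - f (Suc k)) / a)) \<longlonglongrightarrow> 0" by simp
  have "norm (w (Suc k)) \<le> b * sqrt ((M k - f (Suc k)) / a)" for k
  proof -
    have "(norm (x (Suc k) - x k))\<^sup>2 \<le> (M k - f (Suc k)) / a"
      using descent[of k] \<open>a > 0\<close> by (simp add: field_simps)
    then have "norm (x (Suc k) - x k) \<le> sqrt ((M k - f (Suc k)) / a)" by (rule real_le_rsqrt)
    with w_le[of k] \<open>b > 0\<close> show ?thesis by (simp add: mult_left_mono order_trans)
  qed
  then have "(\<lambda>k. w (Suc k)) \<longlonglongrightarrow> 0"
    by (rule Lim_null_comparison[OF always_eventually[OF allI] rhs_lim])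
  then have w_lim: "w \<longlonglongrightarrow> 0" by (rule LIMSEQ_imp_Suc)

  have "f k \<le> M 0" for k
    using f_le[of 0 0] f_Suc_le[of "k - 1"] antimonoD[OF anti, of 0 "k - 1"] by (cases k) auto
  then have "range x \<subseteq> {z. \<Phi> z \<le> ereal (M 0)}" by (auto simp: \<Phi>f)
  then have bounded: "bounded (range x)"
    using coercive_sublevel_bounded[OF \<open>coercive \<Phi>\<close>, of "ereal (M 0)"] bounded_subset by auto

  \<comment> \<open>The KL inequality along the whole sequence\<close>
  define P where "P k \<longleftrightarrow> (\<Phi>s < f k \<longrightarrow> (f k - \<Phi>s) powr \<theta> \<le> c * (1 - \<theta>) * norm (w k))" for k
  have "eventually P sequentially"
  \<comment> \<open>Compactness replaces a uniform KL inequality: infinitely many failures would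
    have a convergent subsequence, and KL at its limit excludes them.\<close>
  proof (rule ccontr)
    assume "\<not> eventually P sequentially"
    then have inf: "infinite {k. \<not> P k}"
      by (simp add: cofinite_eq_sequentially[symmetric] eventually_cofinite)
    define r where "r = enumerate {k. \<not> P k}"
    have r: "strict_mono r" "\<And>j. \<not> P (r j)"
      using strict_mono_enumerate[OF inf] enumerate_in_set[OF inf] by (auto simp: r_def)
    have "bounded (range (x \<circ> r))" using bounded by (rule bounded_subset) auto
    then obtain xhat q where q: "strict_mono q" "((x \<circ> r) \<circ> q) \<longlonglongrightarrow> xhat"
      using bounded_imp_convergent_subsequence by blast
    define y where "y = r \<circ> q"
    have y: "strict_mono y" using r(1) q(1) unfolding y_def by (rule strict_mono_o)
    have xy: "(\<lambda>j. x (y j)) \<longlonglongrightarrow> xhat" using q(2) by (simp add: y_def o_def)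
    have \<Phi>y: "(\<lambda>j. \<Phi> (x (y j))) \<longlonglongrightarrow> ereal \<Phi>s"
      using LIMSEQ_subseq_LIMSEQ[OF \<Phi>_lim y] by (simp add: o_def)
    have wy: "(\<lambda>j. w (y j)) \<longlonglongrightarrow> 0"
      using LIMSEQ_subseq_LIMSEQ[OF w_lim y] by (simp add: o_def)
    have "ereal \<Phi>s \<le> \<Phi> xhat"
      using assms(14)[OF y xy] lim_imp_Limsup[OF _ \<Phi>y] by simp
    moreover have "\<Phi> xhat \<le> ereal \<Phi>s"
      using lower_semicontinuous_limit[OF \<open>lower_semicontinuous \<Phi>\<close> xy] lim_imp_Liminf[OF _ \<Phi>y]
      by simp
    ultimately have \<Phi>hat: "\<Phi> xhat = ereal \<Phi>s" by simp
    \<comment> \<open>KL is available only where the subdifferential is nonempty; here it contains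
      the limit 0 of the \<open>w (y j)\<close>.\<close>
    have "0 \<in> limiting_subdiff \<Phi> xhat"
      using limiting_subdiff_closed[OF xy _ _ w wy] \<Phi>y by (simp only: \<Phi>hat) simp
    then have "limiting_subdiff \<Phi> xhat \<noteq> {}" by blast
    from KL_function_powr_eventually[OF KL \<open>c > 0\<close> \<open>\<theta> < 1\<close> this xy, of "\<lambda>j. w (y j)"]
    have "\<forall>\<^sub>F j in sequentially. P (y j)"
      using \<Phi>y w by (simp add: \<Phi>hat \<Phi>f P_def)
    then obtain j where "P (y j)" using eventually_happens'[OF sequentially_bot] by blast
    then show False using r(2) by (simp add: y_def)
  qed
  then obtain N where N: "\<And>k. k \<ge> N \<Longrightarrow> P k" by (auto simp: eventually_sequentially)

  \<comment> \<open>Reduction to the real sequences\<close>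
  define s where "s k = M k - \<Phi>s" for k
  define C where "C = c * (1 - \<theta>) * b"
  \<comment> \<open>The threshold forces \<open>l k \<ge> Suc N\<close>, so \<open>P\<close> holds
    at \<open>l k\<close> and \<open>l k - 1\<close> is a true predecessor, as (H2)
    requires.\<close>
  have "s k powr \<theta> \<le> C * Xi \<Phi> x m k" if "k \<ge> Suc (N + m)" for k
  proof (cases "s k = 0")
    case True
    then show ?thesis using \<open>c > 0\<close> \<open>\<theta> < 1\<close> \<open>b > 0\<close> by (simp add: C_def Xi_def)
  next
    case False
    have lN: "l k \<ge> Suc N" using l[of k] that by simp
    have "s k powr \<theta> \<le> c * (1 - \<theta>) * norm (w (l k))"
      using False M_ge[of k] N[of "l k"] lN by (simp add: P_def s_def M_def)
    also have "norm (w (l k)) \<le> b * Xi \<Phi> x m k"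
      using w_le[of "l k - 1"] lN by (simp add: Xi_def l_def)
    finally show ?thesis using \<open>c > 0\<close> \<open>\<theta> < 1\<close> by (simp add: C_def mult_ac)
  qed
  then have KLs: "\<forall>\<^sub>F k in sequentially. s k powr \<theta> \<le> C * Xi \<Phi> x m k"
    unfolding eventually_sequentially by blast
  have descent_s: "a * (Xi \<Phi> x m (k + (m + 1)))\<^sup>2 \<le> s k - s (k + (m + 1))" for k
  proof -
    \<comment> \<open>The window ending at \<open>k + (m + 1)\<close> starts at \<open>k + 1\<close>
      or later, so the step into its maximizer leaves from some \<open>j \<ge> k\<close>, where
      \<open>M j \<le> M k\<close>.\<close>
    obtain j where j: "l (k + (m + 1)) = Suc j" "k \<le> j"
      using l[of "k + (m + 1)"] by (cases "l (k + (m + 1))") auto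
    then have "Xi \<Phi> x m (k + (m + 1)) = norm (x (Suc j) - x j)"
      unfolding Xi_def l_def by simp
    moreover have "M (k + (m + 1)) = f (Suc j)" unfolding M_def j ..
    ultimately show ?thesis
      using descent[of j] antimonoD[OF anti j(2)] by (simp add: s_def)
  qed
  have anti_s: "antimono s" using anti by (auto simp: s_def antimono_def)
  have s_lim: "s \<longlonglongrightarrow> 0"
    using tendsto_diff[OF M_lim tendsto_const[of \<Phi>s]] by (simp add: s_def[abs_def])
  have s_nonneg: "0 \<le> s k" for k using M_ge by (simp add: s_def)
  have Xi_nonneg: "0 \<le> Xi \<Phi> x m k" for k by (simp add: Xi_def)
  have "0 < C" using \<open>c > 0\<close> \<open>\<theta> < 1\<close> \<open>b > 0\<close> by (simp add: C_def)
  note nonmonotone_KL_rates[OF anti_s s_nonneg Xi_nonneg \<open>0 < \<theta>\<close> \<open>\<theta> < 1\<close> \<open>a > 0\<close> this s_lim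
    descent_s KLs]
  then obtain kbar \<rho> \<gamma> where summ: "summable (Xi \<Phi> x m)" and \<rho>\<gamma>: "0 < \<rho>" "\<rho> < 1" "0 < \<gamma>"
    and rate: "\<And>k. k \<ge> kbar \<Longrightarrow> max (\<Sum>j. Xi \<Phi> x m (k + j)) (s k) \<le>
       (if \<theta> \<le> 1/2 then \<gamma> * \<rho> powi \<lfloor>(real k - 1) / (real m + 1)\<rfloor>
        else \<gamma> * real k powr ((1 - \<theta>) / (1 - 2 * \<theta>)))"
    by blast
  \<comment> \<open>The maximum in \<open>rate\<close> thus controls both quantities, and
    \<open>\<gamma>\<close> serves as both constants.\<close>
  have "\<Phi> (x k) - ereal \<Phi>s \<le> ereal (s k)" for k
    using f_le[of k k] by (simp add: \<Phi>f s_def)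
  with rate have "(\<Sum>j. Xi \<Phi> x m (k + j))
        \<le> (if \<theta> \<le> 1/2 then \<gamma> * \<rho> powi \<lfloor>(real k - 1) / (real m + 1)\<rfloor>
           else \<gamma> * real k powr ((1 - \<theta>) / (1 - 2 * \<theta>))) \<and>
      \<Phi> (x k) - ereal \<Phi>s
        \<le> ereal (if \<theta> \<le> 1/2 then \<gamma> * \<rho> powi \<lfloor>(real k - 1) / (real m + 1)\<rfloor>
                 else \<gamma> * real k powr ((1 - \<theta>) / (1 - 2 * \<theta>)))" if "k \<ge> kbar" for k
    using that by (meson ereal_less_eq(3) max.bounded_iff order_trans)
  with \<Phi>_lim summ \<rho>\<gamma> show ?thesis by blast
qed

end
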